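(* Let $\{p(\tau)\}_{\tau\in\mathbb{N}_0}$ be a probability distribution on $\mathbb{N}_0$, let $T$ be a random variable with $\mathbb{P}(T=\tau)=p(\tau)$ for $\tau\in\mathbb{N}_0$, and let $\{(X,T)_t\}_{t\ge 0}$ be the trapped random walk with trapping time distribution $p$, started at the origin, i.e. $\mathbb{P}((X,T)_0=(z,\tau))=p(\tau)$ if $z=0$ and $=0$ otherwise. Let $\sigma_t^2:=\mathbb{E}(X_t^2)$. Suppose that $\mathbb{E}(T)<\infty$ and let $\mathcal{D}:=(\mathbb{E}(T)+1)^{-1}$. Then the sequence $|\sigma_t^2-\mathcal{D}\,t|$ is bounded if and only if $\mathbb{E}(T^2)<\infty$. Furthermore, $\lim_{t\to\infty}\mathcal{D}\,t/\sigma_t^2=1$.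
   Context: $\mathbb{N}_0=\{0,1,2,\dots\}$. Trapped random walk with trapping time distribution $p$: the discrete-time Markov chain $(X,T)_t=(X_t,T_t)$ on $\mathbb{Z}\times\mathbb{N}_0$ with transition probabilities $$\mathbb{P}((X,T)_{t+1}=(z',\tau')\mid (X,T)_t=(z,\tau))=\begin{cases}p(\tau')/2 & \text{if } |z-z'|=1 \text{ and } \tau=0,\\ 1 & \text{if } z=z' \text{ and } \tau'=\tau-1\geq 0,\\ 0&\text{otherwise.}\end{cases}$$ $X_t$ is the position and $T_t$ the remaining trapping time; $T$ without subscript denotes a generic trapping time with law $p$. $\sigma_t^2=\mathbb{E}(X_t^2)$ is the mean squared displacement. *)

theory Defs
  imports "HOL-Probability.Probability"
begin

definition trw_kernel :: "nat pmf \<Rightarrow> int \<times> nat \<Rightarrow> int \<times> nat \<Rightarrow> real" where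
  "trw_kernel p = (\<lambda>(z, \<tau>) (z', \<tau>').
     if \<bar>z - z'\<bar> = 1 \<and> \<tau> = 0 then pmf p \<tau>' / 2
     else if z = z' \<and> int \<tau>' = int \<tau> - 1 then 1
     else 0)"

text \<open>
  A discrete-time Markov chain on a countable state space with initial distribution \<open>\<mu>\<close> and
  transition probabilities \<open>K\<close>. Both are given pointwise. The Markov property is required for
  every history \<open>s 0, \<dots>, s t\<close> of positive probability (\<^const>\<open>cond_prob\<close> is \<open>0\<close> if the
  conditioning event is null); only the values \<open>s i\<close> with \<open>i \<le> t\<close> matter.
\<close>

definition markov_chain ::
  "'a measure \<Rightarrow> ('s :: countable \<Rightarrow> real) \<Rightarrow> ('s \<Rightarrow> 's \<Rightarrow> real) \<Rightarrow> (nat \<Rightarrow> 'a \<Rightarrow> 's) \<Rightarrow> bool" where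
  "markov_chain M \<mu> K Z \<longleftrightarrow>
     prob_space M \<and>
     (\<forall>t. Z t \<in> measurable M (count_space UNIV)) \<and>
     (\<forall>x. \<P>(\<omega> in M. Z 0 \<omega> = x) = \<mu> x) \<and>
     (\<forall>t s y. \<P>(\<omega> in M. \<forall>i\<le>t. Z i \<omega> = s i) > 0 \<longrightarrow>
        \<P>(\<omega> in M. Z (Suc t) \<omega> = y \<bar> \<forall>i\<le>t. Z i \<omega> = s i) = K (s t) y)"

text \<open>
  \<open>X t\<close> is the position and \<open>R t\<close> the remaining trapping time at time \<open>t\<close>; the walk starts
  at the origin with remaining trapping time distributed according to \<open>p\<close>.
\<close>

definition trapped_random_walk ::
  "'a measure \<Rightarrow> nat pmf \<Rightarrow> (nat \<Rightarrow> 'a \<Rightarrow> int) \<Rightarrow> (nat \<Rightarrow> 'a \<Rightarrow> nat) \<Rightarrow> bool" where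
  "trapped_random_walk M p X R \<longleftrightarrow>
     markov_chain M (\<lambda>(z, \<tau>). if z = 0 then pmf p \<tau> else 0) (trw_kernel p)
       (\<lambda>t \<omega>. (X t \<omega>, R t \<omega>))"

definition mean_squared_displacement :: "'a measure \<Rightarrow> (nat \<Rightarrow> 'a \<Rightarrow> int) \<Rightarrow> nat \<Rightarrow> real" where
  "mean_squared_displacement M X t = (\<integral>\<omega>. (real_of_int (X t \<omega>))\<^sup>2 \<partial>M)"

end

theory Submission
  imports Defs
begin

text \<open>
  The walk moves exactly when the residual trapping time \<open>R\<close> vanishes, so
  \<open>\<sigma>\<^sub>t\<^sup>2 = (\<Sum>s<t. u\<^sub>s)\<close> with \<open>u\<^sub>s = P(R\<^sub>s = 0)\<close>. The chain \<open>R\<close> decreases by one outside \<open>0\<close> and is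
  redrawn from \<open>p\<close> at \<open>0\<close>, so for \<open>f x = (\<Sum>j\<le>x. g j)\<close> with \<open>g\<close> bounded and \<open>g 0 = 0\<close>
  \<open>E f(R\<^sub>t) - E f(T) = \<sigma>\<^sub>t\<^sup>2 E f(T) - (\<Sum>s<t. E g(R\<^sub>s))\<close>.
  Taking \<open>g j = 1\<close> for \<open>j > 0\<close> yields \<open>\<sigma>\<^sub>t\<^sup>2 - D t = D (E R\<^sub>t - E T)\<close>, which
  reduces both claims to the growth of \<open>E R\<^sub>t\<close>. Taking \<open>g j = 1\<close> for \<open>j > K\<close> yields
  \<open>E R\<^sub>t \<le> K + (1 + t) E (T - K)\<^sup>+\<close>, hence \<open>E R\<^sub>t = o(t)\<close> and the limit. If \<open>E T\<^sup>2\<close> is finite,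
  \<open>P(R\<^sub>t = x) \<le> P(T \<ge> x)\<close> bounds \<open>E R\<^sub>t\<close>. Conversely, if \<open>E R\<^sub>t \<le> B\<close> for all \<open>t\<close>, then
  \<open>g j = min j K\<close> gives, on dividing by \<open>t\<close>, \<open>D E f(T) \<le> B\<close>, and \<open>K\<close> tends to infinity.
\<close>

section \<open>From the Markov property on path histories to one-time laws\<close>

lemma (in prob_space) distr_eq_measure_pmf:
  fixes H :: "'a \<Rightarrow> 'c :: countable"
  assumes "H \<in> measurable M (count_space UNIV)"
    and "\<And>x. prob {\<omega>\<in>space M. H \<omega> = x} = pmf q x"
  shows "distr M (count_space UNIV) H = measure_pmf q"
proof (rule measure_eqI_countable[where A=UNIV])
  fix x
  have "H -` {x} \<inter> space M = {\<omega>\<in>space M. H \<omega> = x}" by auto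
  then show "emeasure (distr M (count_space UNIV) H) {x} = emeasure (measure_pmf q) {x}"
    using assms by (simp add: emeasure_distr emeasure_eq_measure emeasure_pmf_single)
qed auto

text \<open>In a countable type the points of mass zero form a null set, so almost every point is an
  atom, which is the condition for \<open>Abs_pmf\<close> to represent the law.\<close>

lemma (in prob_space) countable_distr_pmf:
  fixes H :: "'a \<Rightarrow> 'c :: countable"
  assumes [measurable]: "H \<in> measurable M (count_space UNIV)"
  obtains q where "distr M (count_space UNIV) H = measure_pmf q"
proof -
  interpret D: prob_space "distr M (count_space UNIV) H" by (rule prob_space_distr) fact
  have "AE x in distr M (count_space UNIV) H. D.prob {x} \<noteq> 0"
    by (subst D.AE_support_countable) (auto intro!: exI[of _ UNIV] simp: AE_all_countable)
  then have "distr M (count_space UNIV) H = measure_pmf (Abs_pmf (distr M (count_space UNIV) H))"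
    by (subst Abs_pmf_inverse) (auto intro: D.prob_space_axioms)
  then show ?thesis by (rule that)
qed

text \<open>The Markov property conditions on whole histories, but the transition probability
  depends on the last state alone. Summing over all histories up to \<open>t\<close> therefore
  leaves an average over \<open>Z t\<close>.\<close>

lemma markov_chain_step:
  fixes Z :: "nat \<Rightarrow> 'a \<Rightarrow> 's :: countable"
  assumes mc: "markov_chain M \<mu> K Z" and K: "\<And>x y. K x y \<ge> 0"
  shows "emeasure M {\<omega>\<in>space M. Z (Suc t) \<omega> = y} = (\<integral>\<^sup>+\<omega>. ennreal (K (Z t \<omega>) y) \<partial>M)"
proof -
  interpret prob_space M using mc by (simp add: markov_chain_def)
  have Z[measurable]: "Z i \<in> measurable M (count_space UNIV)" for i
    using mc by (simp add: markov_chain_def)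
  \<comment> \<open>Histories are finite lists rather than functions on all times, so that they
    range over a countable type and can be summed over.\<close>
  define H where "H \<omega> = map (\<lambda>i. Z i \<omega>) [0..<Suc t]" for \<omega>
  have H_iff: "H \<omega> = l \<longleftrightarrow> length l = Suc t \<and> (\<forall>i\<le>t. Z i \<omega> = l ! i)" for \<omega> l
    unfolding H_def list_eq_iff_nth_eq by (auto simp del: upt_Suc simp: less_Suc_eq_le)
  have H[measurable]: "H \<in> measurable M (count_space UNIV)"
  proof (unfold measurable_count_space_eq2_countable, intro conjI ballI)
    fix l
    have "H -` {l} \<inter> space M = {\<omega>\<in>space M. length l = Suc t \<and> (\<forall>i\<le>t. Z i \<omega> = l ! i)}"
      using H_iff by auto
    then show "H -` {l} \<inter> space M \<in> sets M" by simp
  qed auto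
  obtain q where q: "distr M (count_space UNIV) H = measure_pmf q"
    using countable_distr_pmf[OF H] .
  have last_H: "last (H \<omega>) = Z t \<omega>" for \<omega> by (simp add: H_def)
  have pmf_q: "pmf q l = prob {\<omega>\<in>space M. H \<omega> = l}" for l
  proof -
    have "H -` {l} \<inter> space M = {\<omega>\<in>space M. H \<omega> = l}" by auto
    then show ?thesis by (simp add: pmf.rep_eq q[symmetric] measure_distr)
  qed
  have single: "prob {\<omega>\<in>space M. Z (Suc t) \<omega> = y \<and> H \<omega> = l} = pmf q l * K (last l) y" for l
  \<comment> \<open>A null history carries no conditional information, but there both sides vanish
    anyway.\<close>
  proof (cases "pmf q l = 0")
    case True
    have "prob {\<omega>\<in>space M. Z (Suc t) \<omega> = y \<and> H \<omega> = l} \<le> prob {\<omega>\<in>space M. H \<omega> = l}"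
      by (intro finite_measure_mono) auto
    with True show ?thesis by (simp add: pmf_q measure_le_0_iff)
  next
    case False
    then have "{\<omega>\<in>space M. H \<omega> = l} \<noteq> {}" unfolding pmf_q by (metis measure_empty)
    then have len: "length l = Suc t" using H_iff by auto
    have eq: "H \<omega> = l \<longleftrightarrow> (\<forall>i\<le>t. Z i \<omega> = l ! i)" for \<omega> using H_iff len by auto
    have "prob {\<omega>\<in>space M. \<forall>i\<le>t. Z i \<omega> = l ! i} > 0"
      using False unfolding pmf_q eq by (simp add: zero_less_measure_iff)
    then have "\<P>(\<omega> in M. Z (Suc t) \<omega> = y \<bar> \<forall>i\<le>t. Z i \<omega> = l ! i) = K (l ! t) y"
      using mc unfolding markov_chain_def by blast
    moreover have "l ! t = last l" using len by (metis diff_Suc_1 last_conv_nth list.size(3) nat.distinct(1))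
    ultimately show ?thesis using False unfolding pmf_q cond_prob_def eq[symmetric]
      by (simp add: field_simps)
  qed
  have "emeasure M {\<omega>\<in>space M. Z (Suc t) \<omega> = y}
      = emeasure M (\<Union>l. {\<omega>\<in>space M. Z (Suc t) \<omega> = y \<and> H \<omega> = l})"
    by (rule arg_cong[where f="emeasure M"]) auto
  also have "\<dots> = (\<integral>\<^sup>+l. emeasure M {\<omega>\<in>space M. Z (Suc t) \<omega> = y \<and> H \<omega> = l} \<partial>count_space UNIV)"
    by (rule emeasure_UN_countable) (auto simp: disjoint_family_on_def)
  also have "\<dots> = (\<integral>\<^sup>+l. ennreal (pmf q l) * ennreal (K (last l) y) \<partial>count_space UNIV)"
    by (simp add: emeasure_eq_measure single ennreal_mult K)
  also have "\<dots> = (\<integral>\<^sup>+l. ennreal (K (last l) y) \<partial>distr M (count_space UNIV) H)"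
    by (simp add: q nn_integral_measure_pmf)
  also have "\<dots> = (\<integral>\<^sup>+\<omega>. ennreal (K (Z t \<omega>) y) \<partial>M)"
    by (subst nn_integral_distr) (auto simp: last_H)
  finally show ?thesis .
qed

text \<open>Only the law at each single time is kept: the mean squared displacement and the
  expectations of the residual time depend on nothing else.\<close>

primrec markov_law :: "'s pmf \<Rightarrow> ('s \<Rightarrow> 's pmf) \<Rightarrow> nat \<Rightarrow> 's pmf" where
  "markov_law \<mu> \<kappa> 0 = \<mu>"
| "markov_law \<mu> \<kappa> (Suc t) = bind_pmf (markov_law \<mu> \<kappa> t) \<kappa>"

lemma markov_chain_distr:
  fixes Z :: "nat \<Rightarrow> 'a \<Rightarrow> 's :: countable"
  assumes mc: "markov_chain M (pmf \<mu>) (\<lambda>x. pmf (\<kappa> x)) Z"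
  shows "distr M (count_space UNIV) (Z t) = measure_pmf (markov_law \<mu> \<kappa> t)"
proof -
  interpret prob_space M using mc by (simp add: markov_chain_def)
  have Z[measurable]: "Z i \<in> measurable M (count_space UNIV)" for i
    using mc by (simp add: markov_chain_def)
  show ?thesis
  proof (induction t)
    case 0
    show ?case using mc by (intro distr_eq_measure_pmf) (auto simp: markov_chain_def)
  next
    case (Suc t)
    show ?case
    proof (intro distr_eq_measure_pmf)
      fix y
      have "emeasure M {\<omega>\<in>space M. Z (Suc t) \<omega> = y}
          = (\<integral>\<^sup>+x. ennreal (pmf (\<kappa> x) y) \<partial>distr M (count_space UNIV) (Z t))"
        by (subst markov_chain_step[OF mc]) (auto simp: nn_integral_distr)
      also have "\<dots> = ennreal (pmf (markov_law \<mu> \<kappa> (Suc t)) y)"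
        by (simp add: Suc ennreal_pmf_bind)
      finally show "prob {\<omega>\<in>space M. Z (Suc t) \<omega> = y} = pmf (markov_law \<mu> \<kappa> (Suc t)) y"
        by (simp add: emeasure_eq_measure)
    qed simp
  qed
qed

section \<open>The walk and its squared displacement in terms of the residual time\<close>

text \<open>The rows of \<open>trw_kernel\<close> are packaged as distributions so that the chain
  can be iterated by \<open>bind_pmf\<close>.\<close>

definition trw_step :: "nat pmf \<Rightarrow> int \<times> nat \<Rightarrow> (int \<times> nat) pmf" where
  "trw_step p = (\<lambda>(z, \<tau>). case \<tau> of
     0 \<Rightarrow> pair_pmf (pmf_of_set {z - 1, z + 1}) p
   | Suc k \<Rightarrow> return_pmf (z, k))"

lemma pmf_trw_step: "pmf (trw_step p x) y = trw_kernel p x y"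
  by (cases x; cases y; cases "snd x")
    (auto simp: trw_step_def trw_kernel_def pmf_pair indicator_def split: if_splits)

abbreviation trw_law :: "nat pmf \<Rightarrow> nat \<Rightarrow> (int \<times> nat) pmf" where
  "trw_law p \<equiv> markov_law (map_pmf (Pair 0) p) (trw_step p)"

lemma trapped_random_walk_distr:
  assumes "trapped_random_walk M p X R"
  shows "distr M (count_space UNIV) (\<lambda>\<omega>. (X t \<omega>, R t \<omega>)) = measure_pmf (trw_law p t)"
proof (rule markov_chain_distr)
  have "pmf (map_pmf (Pair 0) p) (z, \<tau>) = (if z = 0 then pmf p \<tau> else 0)" for z :: int and \<tau>
    by (auto simp: pmf_map_inj' inj_on_def pmf_eq_0_set_pmf)
  then have "pmf (map_pmf (Pair 0) p) = (\<lambda>(z, \<tau>). if z = (0::int) then pmf p \<tau> else 0)"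
    by auto
  moreover have "(\<lambda>x. pmf (trw_step p x)) = trw_kernel p"
    by (intro ext pmf_trw_step)
  ultimately show "markov_chain M (pmf (map_pmf (Pair 0) p)) (\<lambda>x. pmf (trw_step p x))
      (\<lambda>t \<omega>. (X t \<omega>, R t \<omega>))"
    using assms by (simp add: trapped_random_walk_def)
qed

text \<open>This is the residual lifetime of a renewal process with waiting times T + 1. Its mass at
  0 is the probability of a renewal, that is, of a jump of the walk in the next step.\<close>

abbreviation residual_law :: "nat pmf \<Rightarrow> nat \<Rightarrow> nat pmf" where
  "residual_law p \<equiv> markov_law p (case_nat p return_pmf)"

text \<open>The next residual time never depends on the position, so the second coordinate is a
  Markov chain by itself.\<close>

lemma map_snd_trw_law: "map_pmf snd (trw_law p t) = residual_law p t"
proof (induction t)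
  case 0
  show ?case by (simp add: pmf.map_comp o_def)
next
  case (Suc t)
  have "map_pmf snd (trw_step p x) = case_nat p return_pmf (snd x)" for x
    by (auto simp: trw_step_def map_snd_pair_pmf split: prod.split nat.split)
  then have "map_pmf snd (trw_law p (Suc t)) = bind_pmf (map_pmf snd (trw_law p t)) (case_nat p return_pmf)"
    by (simp add: map_bind_pmf bind_map_pmf)
  then show ?case by (simp add: Suc)
qed

text \<open>A jump is symmetric, so the cross term in the square cancels and each jump adds exactly
  1 on average. Nonnegative integrals make a prior proof of integrability unnecessary.\<close>

lemma second_moment_trw_law:
  "(\<integral>\<^sup>+x. ennreal ((real_of_int (fst x))\<^sup>2) \<partial>trw_law p t)
    = ennreal (\<Sum>s<t. pmf (residual_law p s) 0)"
proof (induction t)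
  case 0
  show ?case by simp
next
  case (Suc t)
  have step: "(\<integral>\<^sup>+y. ennreal ((real_of_int (fst y))\<^sup>2) \<partial>trw_step p x)
      = ennreal ((real_of_int (fst x))\<^sup>2) + indicator {0} (snd x)" for x
  proof (cases x)
    case (Pair z \<tau>)
    have [simp]: "z - 1 \<noteq> z + 1" by simp
    have "(\<integral>\<^sup>+y. ennreal ((real_of_int (fst y))\<^sup>2) \<partial>pair_pmf (pmf_of_set {z - 1, z + 1}) p)
        = (\<integral>\<^sup>+y. ennreal ((real_of_int y)\<^sup>2) \<partial>map_pmf fst (pair_pmf (pmf_of_set {z - 1, z + 1}) p))"
      by simp
    also have "\<dots> = (\<integral>\<^sup>+y. ennreal ((real_of_int y)\<^sup>2) \<partial>pmf_of_set {z - 1, z + 1})"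
      by (simp only: map_fst_pair_pmf)
    also have "\<dots> = (\<Sum>y\<in>{z - 1, z + 1}. ennreal ((real_of_int y)\<^sup>2) * pmf (pmf_of_set {z - 1, z + 1}) y)"
      by (intro nn_integral_measure_pmf_support) auto
    also have "\<dots> = ennreal (\<Sum>y\<in>{z - 1, z + 1}. (real_of_int y)\<^sup>2 * pmf (pmf_of_set {z - 1, z + 1}) y)"
      by (subst sum_ennreal[symmetric]) (simp_all only: ennreal_mult' zero_le_power2 pmf_nonneg mult_nonneg_nonneg)
    also have "(\<Sum>y\<in>{z - 1, z + 1}. (real_of_int y)\<^sup>2 * pmf (pmf_of_set {z - 1, z + 1}) y) = (real_of_int z)\<^sup>2 + 1"
      by (simp add: power2_eq_square field_simps)
    finally show ?thesis
      by (auto simp: Pair trw_step_def indicator_def ennreal_plus split: nat.split)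
  qed
  have "(\<integral>\<^sup>+x. indicator {0} (snd x) \<partial>trw_law p t) = (\<integral>\<^sup>+\<tau>. indicator {0} \<tau> \<partial>map_pmf snd (trw_law p t))"
    by simp
  also have "\<dots> = ennreal (pmf (residual_law p t) 0)"
    unfolding map_snd_trw_law by (simp add: emeasure_pmf_single)
  finally show ?case
    by (simp add: step nn_integral_add Suc sum_nonneg)
qed

lemma mean_squared_displacement_eq:
  assumes "trapped_random_walk M p X R"
  shows "mean_squared_displacement M X t = (\<Sum>s<t. pmf (residual_law p s) 0)"
proof -
  have [measurable]: "(\<lambda>\<omega>. (X t \<omega>, R t \<omega>)) \<in> measurable M (count_space UNIV)"
    using assms by (simp add: trapped_random_walk_def markov_chain_def)
  have "mean_squared_displacement M X t
      = (\<integral>x. (real_of_int (fst x))\<^sup>2 \<partial>distr M (count_space UNIV) (\<lambda>\<omega>. (X t \<omega>, R t \<omega>)))"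
    by (subst integral_distr) (auto simp: mean_squared_displacement_def)
  also have "\<dots> = (\<Sum>s<t. pmf (residual_law p s) 0)"
    by (simp add: trapped_random_walk_distr[OF assms] integral_eq_nn_integral second_moment_trw_law sum_nonneg)
  finally show ?thesis .
qed

section \<open>Expectations under the law of the residual time\<close>

text \<open>For indicators \<open>f\<close> this is \<open>P(R\<^sub>t = j) \<le> P(T \<ge> j)\<close>.\<close>

lemma nn_integral_residual_law_le:
  fixes f :: "nat \<Rightarrow> ennreal"
  shows "(\<integral>\<^sup>+x. f x \<partial>residual_law p t) \<le> (\<integral>\<^sup>+x. (\<Sum>j\<le>x. f j) \<partial>p)"
proof (induction t arbitrary: f)
  case 0
  have "f x \<le> (\<Sum>j\<le>x. f j)" for x by (intro member_le_sum) auto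
  then show ?case by (auto intro: nn_integral_mono)
next
  case (Suc t)
  \<comment> \<open>\<open>?g\<close> accounts for the deterministic descent from
    \<open>x > 0\<close>. The redraw, which happens only at 0, is overestimated by adding the mean
    of \<open>f\<close> under \<open>p\<close> at every state.\<close>
  let ?g = "case_nat 0 f"
  have split: "(\<integral>\<^sup>+y. f y \<partial>case_nat p return_pmf x) \<le> ?g x + (\<integral>\<^sup>+y. f y \<partial>p)" for x
    by (cases x) auto
  have "(\<Sum>j\<le>x. ?g j) = (\<Sum>j<x. f j)" for x
    by (subst sum.atMost_shift) simp
  then have "(\<Sum>j\<le>x. ?g j) + f x = (\<Sum>j\<le>x. f j)" for x
    by (simp add: lessThan_Suc_atMost[symmetric])
  moreover have "(\<integral>\<^sup>+x. (\<Sum>j\<le>x. ?g j) + f x \<partial>p) = (\<integral>\<^sup>+x. (\<Sum>j\<le>x. ?g j) \<partial>p) + (\<integral>\<^sup>+x. f x \<partial>p)"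
    by (intro nn_integral_add) auto
  ultimately have eq: "(\<integral>\<^sup>+x. (\<Sum>j\<le>x. ?g j) \<partial>p) + (\<integral>\<^sup>+x. f x \<partial>p) = (\<integral>\<^sup>+x. (\<Sum>j\<le>x. f j) \<partial>p)"
    by simp
  have "(\<integral>\<^sup>+x. f x \<partial>residual_law p (Suc t)) \<le> (\<integral>\<^sup>+x. ?g x + (\<integral>\<^sup>+y. f y \<partial>p) \<partial>residual_law p t)"
    by (simp add: split nn_integral_mono)
  also have "\<dots> = (\<integral>\<^sup>+x. ?g x \<partial>residual_law p t) + (\<integral>\<^sup>+y. f y \<partial>p)"
    by (simp add: nn_integral_add)
  also have "\<dots> \<le> (\<integral>\<^sup>+x. (\<Sum>j\<le>x. ?g j) \<partial>p) + (\<integral>\<^sup>+x. f x \<partial>p)"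
    by (intro add_right_mono Suc)
  finally show ?case by (simp only: eq)
qed

text \<open>Averaging over the last transition gives the mean under \<open>p\<close> at 0 and the
  preceding value of \<open>f\<close> elsewhere. A single equation of nonnegative integrals delivers
  both integrability and the value.\<close>

lemma expectation_residual_law_Suc:
  fixes p :: "nat pmf" and f :: "nat \<Rightarrow> real"
  assumes nonneg: "\<And>x. f x \<ge> 0" and int: "integrable p f"
  shows "integrable (residual_law p (Suc t)) f
      \<longleftrightarrow> integrable (residual_law p t) (case_nat (measure_pmf.expectation p f) f)" (is ?A)
    and "measure_pmf.expectation (residual_law p (Suc t)) f
      = measure_pmf.expectation (residual_law p t) (case_nat (measure_pmf.expectation p f) f)" (is ?B)
proof -
  let ?g = "case_nat (measure_pmf.expectation p f) f"
  have g: "?g x \<ge> 0" for x using nonneg by (cases x) auto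
  have "(\<integral>\<^sup>+y. ennreal (f y) \<partial>case_nat p return_pmf x) = ennreal (?g x)" for x
    using int nonneg by (cases x) (auto simp: nn_integral_eq_integral)
  then have eq: "(\<integral>\<^sup>+y. ennreal (f y) \<partial>residual_law p (Suc t)) = (\<integral>\<^sup>+x. ennreal (?g x) \<partial>residual_law p t)"
    by simp
  show ?A using eq by (simp add: integrable_iff_bounded g nonneg del: markov_law.simps)
  have E: "measure_pmf.expectation q h = enn2real (\<integral>\<^sup>+x. ennreal (h x) \<partial>q)" if "\<And>x. h x \<ge> 0" for q :: "nat pmf" and h
    using that by (simp add: integral_eq_nn_integral)
  show ?B using arg_cong[OF eq, of enn2real] unfolding E[OF g, symmetric] E[OF nonneg, symmetric] .
qed

lemma integrable_residual_law:
  fixes p :: "nat pmf"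
  assumes "integrable p real"
  shows "integrable (residual_law p t) real"
proof (induction t)
  case 0
  show ?case using assms by simp
next
  case (Suc t)
  show ?case
  proof (subst expectation_residual_law_Suc)
    let ?c = "measure_pmf.expectation p real"
    have "?c \<ge> 0" by simp
    then show "integrable (residual_law p t) (case_nat ?c real)"
      by (intro Bochner_Integration.integrable_bound[of _ "\<lambda>x. ?c + real x" "case_nat ?c real"])
        (auto intro: Suc split: nat.split)
  qed (use assms in auto)
qed

lemma integrable_linear_growth:
  fixes f :: "nat \<Rightarrow> real" and p :: "nat pmf"
  assumes "integrable p real" "\<And>x. \<bar>f x\<bar> \<le> C * real x"
  shows "integrable p f"
  by (rule Bochner_Integration.integrable_bound[of _ "\<lambda>x. C * real x"])
    (use assms in \<open>auto intro: order_trans[OF assms(2) abs_ge_self]\<close>)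

text \<open>Since \<open>g\<close> is the increment of \<open>f\<close>, one descent costs
  \<open>g x\<close>, while a redraw from 0, where \<open>f\<close> vanishes, gains the mean of
  \<open>f\<close> under \<open>p\<close>. Summing these balances over time gives the identity; the
  bound on \<open>g\<close> makes \<open>f\<close> grow at most linearly.\<close>

lemma expectation_residual_law:
  fixes p :: "nat pmf" and g :: "nat \<Rightarrow> real"
  defines "f \<equiv> \<lambda>x. \<Sum>j\<le>x. g j"
  assumes int: "integrable p real" and "g 0 = 0" and g: "\<And>x. 0 \<le> g x" "\<And>x. g x \<le> C"
  shows "measure_pmf.expectation (residual_law p t) f
      = (1 + (\<Sum>s<t. pmf (residual_law p s) 0)) * measure_pmf.expectation p f
        - (\<Sum>s<t. measure_pmf.expectation (residual_law p s) g)"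
proof (induction t)
  case 0
  show ?case by simp
next
  case (Suc t)
  let ?E = "measure_pmf.expectation (residual_law p t)"
  have f_nonneg: "f x \<ge> 0" for x unfolding f_def by (intro sum_nonneg g)
  have "f x \<le> C * real x" for x
  proof (induction x)
    case 0
    show ?case using \<open>g 0 = 0\<close> by (simp add: f_def)
  next
    case (Suc x)
    then show ?case using g(2)[of "Suc x"] by (simp add: f_def algebra_simps)
  qed
  then have f_int: "integrable q f" if "integrable (measure_pmf q) real" for q
    using f_nonneg by (intro integrable_linear_growth[OF that, of _ C]) simp
  have g_int: "integrable (residual_law p t) g"
    by (rule measure_pmf.integrable_const_bound[where B=C]) (use g in auto)
  have "case_nat c f x = f x - g x + c * indicator {0} x" for c x
    using \<open>g 0 = 0\<close> by (cases x) (auto simp: f_def)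
  then have "?E (case_nat c f) = ?E (\<lambda>x. f x - g x + c * indicator {0} x)" for c
    by presburger
  also have "?E (\<lambda>x. f x - g x + c * indicator {0} x) = ?E f - ?E g + c * pmf (residual_law p t) 0" for c
  proof -
    have "integrable (residual_law p t) (\<lambda>x. c * indicator {0} x)"
      by (intro integrable_mult_right) (simp add: measure_pmf.emeasure_eq_measure)
    moreover have "?E (\<lambda>x. c * indicator {0} x) = c * pmf (residual_law p t) 0"
      by (simp add: measure_pmf_single)
    ultimately show ?thesis
      using f_int[OF integrable_residual_law[OF int], of t] g_int by simp
  qed
  finally have "?E (case_nat c f) = ?E f - ?E g + c * pmf (residual_law p t) 0" for c .
  from this[of "measure_pmf.expectation p f"] show ?case
    using Suc by (subst expectation_residual_law_Suc[OF f_nonneg f_int[OF int]]) (simp add: algebra_simps)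
qed

section \<open>Renewal count and mean residual time when T has finite mean\<close>

text \<open>Truncated subtraction makes the right side the positive part of x - K. It identifies the
  cumulative \<open>f\<close> for tail indicators; \<open>K = 0\<close> gives \<open>real\<close>
  itself.\<close>

lemma sum_indicator_greater: "(\<Sum>j\<le>x. indicator {K<..} j) = real (x - K)"
  by (induction x) (auto simp: indicator_def Suc_diff_le)

context
  fixes p :: "nat pmf"
  assumes int: "integrable p real"
begin

text \<open>With the indicator of positive values as \<open>g\<close>, the renewal count enters
  twice: as the number of redraws and, through the complement, in the time spent away from 0. The
  resulting equation is linear in it.\<close>

lemma renewal_count_eq:
  defines "\<mu> \<equiv> measure_pmf.expectation p real"
  shows "(\<Sum>s<t. pmf (residual_law p s) 0)
    = inverse (\<mu> + 1) * (real t + measure_pmf.expectation (residual_law p t) real - \<mu>)"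
proof -
  let ?S = "\<Sum>s<t. pmf (residual_law p s) 0"
  have "\<mu> \<ge> 0" by (simp add: \<mu>_def)
  have "measure_pmf.expectation (residual_law p s) (indicator {0<..}) = 1 - pmf (residual_law p s) 0" for s
  proof -
    have "{0<..} = - {0::nat}" by auto
    then show ?thesis
      by (simp add: measure_pmf.prob_compl[of "{0}", simplified] Compl_eq_Diff_UNIV measure_pmf_single)
  qed
  then have "measure_pmf.expectation (residual_law p t) real = (1 + ?S) * \<mu> - (real t - ?S)"
    using expectation_residual_law[OF int, of "indicator {0<..}" 1 t]
    by (simp add: sum_indicator_greater sum_subtractf \<mu>_def)
  with \<open>\<mu> \<ge> 0\<close> show ?thesis by (simp add: field_simps)
qed

lemma mean_residual_sublinear:
  "(\<lambda>t. measure_pmf.expectation (residual_law p t) real / real t) \<longlonglongrightarrow> 0"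
proof (rule LIMSEQ_I)
  fix e :: real assume "e > 0"
  \<comment> \<open>The overshoot above \<open>K\<close> tends to 0 in mean, so some
    \<open>K\<close> makes the slope of the linear bound below at most \<open>e / 4\<close>.\<close>
  have "(\<lambda>K. measure_pmf.expectation p (\<lambda>x. real (x - K))) \<longlonglongrightarrow> measure_pmf.expectation p (\<lambda>x. 0)"
  proof (rule integral_dominated_convergence[where w=real])
    show "AE x in p. (\<lambda>K. real (x - K)) \<longlonglongrightarrow> 0"
      by (intro AE_I2 tendsto_eventually eventually_sequentiallyI) simp
  qed (use int in auto)
  then have "eventually (\<lambda>K. measure_pmf.expectation p (\<lambda>x. real (x - K)) < e / 4) sequentially"
    using \<open>e > 0\<close> by (intro order_tendstoD(2)) auto
  then obtain K where K: "measure_pmf.expectation p (\<lambda>x. real (x - K)) < e / 4"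
    by (auto simp: eventually_sequentially)
  have bound: "measure_pmf.expectation (residual_law p t) real \<le> real K + (1 + real t) * (e / 4)" for t
  proof -
    let ?E = "measure_pmf.expectation (residual_law p t)"
    note int_t = integrable_residual_law[OF int, of t]
    have trunc: "integrable (residual_law p t) (\<lambda>x. real (x - K))"
      by (rule integrable_linear_growth[OF int_t, of _ 1]) auto
    have "?E real \<le> ?E (\<lambda>x. real K + real (x - K))"
      using int_t trunc by (intro integral_mono) auto
    also have "\<dots> = real K + ?E (\<lambda>x. real (x - K))"
      using trunc by simp
    \<comment> \<open>The subtracted sum of tail probabilities is nonnegative and is
      dropped.\<close>
    also have "?E (\<lambda>x. real (x - K))
        \<le> (1 + (\<Sum>s<t. pmf (residual_law p s) 0)) * measure_pmf.expectation p (\<lambda>x. real (x - K))"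
      using expectation_residual_law[OF int, of "indicator {K<..}" 1 t]
      by (simp add: sum_indicator_greater sum_nonneg)
    also have "\<dots> \<le> (1 + real t) * (e / 4)"
    proof (intro mult_mono)
      show "1 + (\<Sum>s<t. pmf (residual_law p s) 0) \<le> 1 + real t"
        using sum_bounded_above[of "{..<t}" "\<lambda>s. pmf (residual_law p s) 0" 1] by (simp add: pmf_le_1)
    qed (use K in auto)
    finally show ?thesis by simp
  qed
  obtain n where n: "real n > (real K + e) * 4 / e" using reals_Archimedean2 by blast
  have "norm (measure_pmf.expectation (residual_law p t) real / real t - 0) < e" if "t \<ge> Suc n" for t
  proof -
    have "real t * e > (real K + e) * 4"
      using n \<open>e > 0\<close> that by (smt (verit) pos_divide_less_eq of_nat_mono mult_right_mono of_nat_Suc)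
    then have "real K + (1 + real t) * (e / 4) < e * real t"
      using \<open>e > 0\<close> by (simp add: field_simps)
    with bound[of t] have "measure_pmf.expectation (residual_law p t) real < e * real t" by linarith
    then show ?thesis using that by (simp add: field_simps)
  qed
  then show "\<exists>n. \<forall>t\<ge>n. norm (measure_pmf.expectation (residual_law p t) real / real t - 0) < e"
    by blast
qed

lemma renewal_count_over_time:
  "(\<lambda>t. (\<Sum>s<t. pmf (residual_law p s) 0) / real t) \<longlonglongrightarrow> inverse (measure_pmf.expectation p real + 1)"
proof -
  let ?\<mu> = "measure_pmf.expectation p real"
  have "(\<lambda>t. inverse (?\<mu> + 1) * (1 + (measure_pmf.expectation (residual_law p t) real / real t - ?\<mu> / real t)))
      \<longlonglongrightarrow> inverse (?\<mu> + 1) * (1 + (0 - 0))"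
    by (intro tendsto_intros mean_residual_sublinear lim_const_over_n)
  moreover have "eventually (\<lambda>t. inverse (?\<mu> + 1) * (1 + (measure_pmf.expectation (residual_law p t) real / real t - ?\<mu> / real t))
      = (\<Sum>s<t. pmf (residual_law p s) 0) / real t) sequentially"
    by (intro eventually_sequentiallyI[of 1]) (simp add: renewal_count_eq field_simps)
  ultimately show ?thesis
    by (simp cong: filterlim_cong)
qed

text \<open>The bound is the mean of 0 + ... + T, which is quadratic in T and does not depend on
  \<open>t\<close>.\<close>

lemma mean_residual_bounded:
  assumes sq: "integrable p (\<lambda>x. (real x)\<^sup>2)"
  shows "\<exists>B. \<forall>t. measure_pmf.expectation (residual_law p t) real \<le> B"
proof (intro exI allI)
  fix t
  have F_int: "integrable p (\<lambda>x. \<Sum>j\<le>x. real j)"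
  proof (rule Bochner_Integration.integrable_bound)
    show "integrable p (\<lambda>x. (real x)\<^sup>2 + real x)" using int sq by simp
    have "(\<Sum>j\<le>x. real j) \<le> (real x)\<^sup>2 + real x" for x
      using sum_bounded_above[of "{..x}" real "real x"] by (simp add: algebra_simps power2_eq_square)
    then show "AE x in p. norm (\<Sum>j\<le>x. real j) \<le> norm ((real x)\<^sup>2 + real x)"
      by (intro AE_I2) (simp add: sum_nonneg)
  qed simp
  have "ennreal (measure_pmf.expectation (residual_law p t) real) = (\<integral>\<^sup>+x. ennreal (real x) \<partial>residual_law p t)"
    using integrable_residual_law[OF int] by (simp add: nn_integral_eq_integral)
  also have "\<dots> \<le> (\<integral>\<^sup>+x. (\<Sum>j\<le>x. ennreal (real j)) \<partial>p)" by (rule nn_integral_residual_law_le)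
  also have "\<dots> = ennreal (measure_pmf.expectation p (\<lambda>x. \<Sum>j\<le>x. real j))"
    using F_int by (simp add: nn_integral_eq_integral sum_nonneg)
  finally show "measure_pmf.expectation (residual_law p t) real \<le> measure_pmf.expectation p (\<lambda>x. \<Sum>j\<le>x. real j)"
    by (simp add: sum_nonneg integral_nonneg)
qed

lemma second_moment_if_mean_residual_bounded:
  assumes B: "\<And>t. measure_pmf.expectation (residual_law p t) real \<le> B"
  shows "integrable p (\<lambda>x. (real x)\<^sup>2)"
proof -
  \<comment> \<open>Truncating the increments at \<open>K\<close> keeps them bounded, as the balance
    identity requires, while \<open>f K x\<close> still increases to 0 + ... + x.\<close>
  define f where "f K x = (\<Sum>j\<le>x. real (min j K))" for K x
  define D where "D = inverse (measure_pmf.expectation p real + 1)"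
  have "D > 0" unfolding D_def by (simp add: add_nonneg_pos)
  have f_nonneg: "f K x \<ge> 0" for K x by (simp add: f_def sum_nonneg)
  have f_le: "f K x \<le> real K * real x" for K x
    by (induction x) (auto simp: f_def algebra_simps min_def)
  have f_int: "integrable p (f K)" for K
    using f_nonneg f_le by (intro integrable_linear_growth[OF int, of _ "real K"]) auto
  have bound: "measure_pmf.expectation p (f K) \<le> B / D" for K
  proof -
    let ?E = "\<lambda>t. measure_pmf.expectation (residual_law p t)"
    let ?c = "measure_pmf.expectation p (f K)"
    let ?S = "\<lambda>t. \<Sum>s<t. pmf (residual_law p s) 0"
    \<comment> \<open>Only the first term on the right depends on \<open>K\<close>, and it stays
      constant in \<open>t\<close>, so it disappears after division by \<open>t\<close>.\<close>
    have ineq: "?S t * ?c \<le> real K * B + real t * B" for t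
    proof -
      have "?E t (f K) \<le> ?E t (\<lambda>x. real K * real x)"
        using integrable_residual_law[OF int, of t] f_le f_nonneg
        by (intro integral_mono integrable_linear_growth[of _ "f K" "real K"]) auto
      also have "\<dots> \<le> real K * B" using B by (simp add: mult_left_mono)
      finally have 1: "?E t (f K) \<le> real K * B" .
      have "?E s (\<lambda>j. real (min j K)) \<le> B" for s
      proof -
        have "?E s (\<lambda>j. real (min j K)) \<le> ?E s real"
          using integrable_residual_law[OF int, of s]
          by (intro integral_mono integrable_linear_growth[of _ "\<lambda>j. real (min j K)" 1]) auto
        with B show ?thesis using order_trans by blast
      qed
      then have 2: "(\<Sum>s<t. ?E s (\<lambda>j. real (min j K))) \<le> real t * B"
        using sum_bounded_above[of "{..<t}" "\<lambda>s. ?E s (\<lambda>j. real (min j K))" B] by simp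
      have "?E t (f K) = (1 + ?S t) * ?c - (\<Sum>s<t. ?E s (\<lambda>j. real (min j K)))"
        using expectation_residual_law[OF int, of "\<lambda>j. real (min j K)" "real K" t]
        by (simp add: f_def[abs_def])
      moreover have "?c \<ge> 0" by (simp add: f_nonneg)
      ultimately show ?thesis using 1 2 by (simp add: algebra_simps)
    qed
    have "(\<lambda>t. ?S t / real t * ?c) \<longlonglongrightarrow> D * ?c"
      unfolding D_def by (intro tendsto_intros renewal_count_over_time)
    moreover have "(\<lambda>t. real K * B / real t + B) \<longlonglongrightarrow> 0 + B"
      by (intro tendsto_intros lim_const_over_n)
    moreover have "\<forall>t\<ge>1. ?S t / real t * ?c \<le> real K * B / real t + B"
      using ineq by (auto simp: field_simps)
    ultimately have "D * ?c \<le> 0 + B" by (intro LIMSEQ_le) blast+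
    then show ?thesis using \<open>D > 0\<close> by (simp add: field_simps)
  qed
  \<comment> \<open>The truncation at \<open>K = x\<close> is already inactive up to
    \<open>x\<close>, so this one index attains the quadratic lower bound.\<close>
  have "ennreal (real x ^ 2 / 2) \<le> (SUP K. ennreal (f K x))" for x
  proof (rule SUP_upper2[of x])
    have "(real x)\<^sup>2 / 2 \<le> (\<Sum>j\<le>x. real j)"
      by (induction x) (auto simp: power2_eq_square algebra_simps)
    also have "\<dots> = f x x" by (auto simp: f_def intro!: sum.cong)
    finally show "ennreal (real x ^ 2 / 2) \<le> ennreal (f x x)" by (rule ennreal_leI)
  qed simp
  then have "(\<integral>\<^sup>+x. ennreal (real x ^ 2 / 2) \<partial>p) \<le> (\<integral>\<^sup>+x. (SUP K. ennreal (f K x)) \<partial>p)"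
    by (rule nn_integral_mono)
  also have "\<dots> = (SUP K. \<integral>\<^sup>+x. ennreal (f K x) \<partial>p)"
  proof (rule nn_integral_monotone_convergence_SUP)
    show "incseq (\<lambda>K x. ennreal (f K x))"
      by (auto simp: incseq_def le_fun_def f_def intro!: ennreal_leI sum_mono)
  qed simp
  also have "\<dots> \<le> ennreal (B / D)"
    using bound by (intro SUP_least) (simp add: nn_integral_eq_integral f_int f_nonneg ennreal_leI)
  finally have "integrable p (\<lambda>x. real x ^ 2 / 2)"
    by (intro integrableI_nonneg) (auto simp: less_top[symmetric] top_unique)
  then have "integrable p (\<lambda>x. 2 * (real x ^ 2 / 2))" by (rule integrable_mult_right)
  then show ?thesis by simp
qed

end

theorem theorem1:
  fixes p :: "nat pmf"
    and N :: "'b measure" and T :: "'b \<Rightarrow> nat"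
    and M :: "'a measure" and X :: "nat \<Rightarrow> 'a \<Rightarrow> int" and R :: "nat \<Rightarrow> 'a \<Rightarrow> nat"
    and D :: real and \<sigma>2 :: "nat \<Rightarrow> real"
  assumes "prob_space N"
    and "T \<in> measurable N (count_space UNIV)"
    and "\<And>\<tau>. \<P>(\<omega> in N. T \<omega> = \<tau>) = pmf p \<tau>"
    and "trapped_random_walk M p X R"
    and "\<And>t. \<sigma>2 t = mean_squared_displacement M X t"
    and "integrable N (\<lambda>\<omega>. real (T \<omega>))"
    and "D = inverse ((\<integral>\<omega>. real (T \<omega>) \<partial>N) + 1)"
  shows "(bounded (range (\<lambda>t. \<bar>\<sigma>2 t - D * real t\<bar>)) \<longleftrightarrow>
            integrable N (\<lambda>\<omega>. (real (T \<omega>))\<^sup>2))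
         \<and> (\<lambda>t. D * real t / \<sigma>2 t) \<longlonglongrightarrow> 1"
proof -
  interpret N: prob_space N by fact
  note [measurable] = assms(2)
  have distr_T: "distr N (count_space UNIV) T = measure_pmf p"
    using assms(2,3) by (rule N.distr_eq_measure_pmf)
  have int_T: "integrable N (\<lambda>\<omega>. h (T \<omega>)) \<longleftrightarrow> integrable p h" for h :: "nat \<Rightarrow> real"
    unfolding distr_T[symmetric] by (subst integrable_distr_eq) auto
  have "(\<integral>\<omega>. real (T \<omega>) \<partial>N) = measure_pmf.expectation p real"
    unfolding distr_T[symmetric] by (subst integral_distr) auto
  then have D: "D = inverse (measure_pmf.expectation p real + 1)" using assms(7) by simp
  have "D > 0" unfolding D by (simp add: add_nonneg_pos)
  have int: "integrable p real" using assms(6) int_T[of real] by simp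
  have \<sigma>2: "\<sigma>2 t = (\<Sum>s<t. pmf (residual_law p s) 0)" for t
    using assms(5) mean_squared_displacement_eq[OF assms(4)] by simp
  let ?m = "\<lambda>t. measure_pmf.expectation (residual_law p t) real"
  let ?\<mu> = "measure_pmf.expectation p real"
  have dev: "\<sigma>2 t - D * real t = D * (?m t - ?\<mu>)" for t
    by (simp add: \<sigma>2 renewal_count_eq[OF int] D algebra_simps)
  \<comment> \<open>By \<open>dev\<close> the deviation is an affine image of the mean residual
    time, which is nonnegative; hence only an upper bound is at stake.\<close>
  have "bounded (range (\<lambda>t. \<bar>\<sigma>2 t - D * real t\<bar>)) \<longleftrightarrow> (\<exists>B. \<forall>t. ?m t \<le> B)"
  proof
    assume "bounded (range (\<lambda>t. \<bar>\<sigma>2 t - D * real t\<bar>))"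
    then obtain C where C: "\<bar>D * (?m t - ?\<mu>)\<bar> \<le> C" for t
      unfolding bounded_iff dev by auto
    have "?m t \<le> C / D + ?\<mu>" for t
      using C[of t] \<open>D > 0\<close> by (simp add: field_simps abs_le_iff)
    then show "\<exists>B. \<forall>t. ?m t \<le> B" by blast
  next
    assume "\<exists>B. \<forall>t. ?m t \<le> B"
    then obtain B where B: "\<And>t. ?m t \<le> B" by blast
    have "\<bar>D * (?m t - ?\<mu>)\<bar> \<le> D * (B + ?\<mu>)" for t
    proof -
      have "0 \<le> ?m t" "0 \<le> ?\<mu>" by simp_all
      with B[of t] have "\<bar>?m t - ?\<mu>\<bar> \<le> B + ?\<mu>" by linarith
      then show ?thesis using \<open>D > 0\<close> by (simp add: abs_mult)
    qed
    then show "bounded (range (\<lambda>t. \<bar>\<sigma>2 t - D * real t\<bar>))"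
      unfolding bounded_iff dev by auto
  qed
  also have "\<dots> \<longleftrightarrow> integrable p (\<lambda>x. (real x)\<^sup>2)"
    using mean_residual_bounded[OF int] second_moment_if_mean_residual_bounded[OF int] by blast
  also have "\<dots> \<longleftrightarrow> integrable N (\<lambda>\<omega>. (real (T \<omega>))\<^sup>2)"
    by (rule int_T[symmetric])
  finally have 1: "bounded (range (\<lambda>t. \<bar>\<sigma>2 t - D * real t\<bar>)) \<longleftrightarrow> integrable N (\<lambda>\<omega>. (real (T \<omega>))\<^sup>2)" .
  \<comment> \<open>The rearranged quotient agrees with the desired one even at
    \<open>t = 0\<close>, where division by zero makes both equal 0.\<close>
  have "(\<lambda>t. D / (\<sigma>2 t / real t)) \<longlonglongrightarrow> D / D"
    unfolding \<sigma>2 using renewal_count_over_time[OF int] \<open>D > 0\<close>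
    by (intro tendsto_intros) (auto simp: D)
  then have 2: "(\<lambda>t. D * real t / \<sigma>2 t) \<longlonglongrightarrow> 1"
    using \<open>D > 0\<close> by simp
  from 1 2 show ?thesis by blast
qed

end
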